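(* Let $n\geq 1$ and $0\le p\le n$ be integers, and let $T^n=(S^1)^n$ be the $n$-dimensional torus. Then $$\mathrm{long}^{\,p}\, T^n = n-p.$$
   Context: **$p$-length.** Let $M$ be an orientable manifold of dimension $m$ and $p\ge0$ an integer. Let $H^*(M;A)$ be the cohomology ring with $A=\mathbb{Z}$ or $\mathbb{R}$. The $p$-length $\mathrm{long}^{\,p}M$ is the largest integer $q$ such that there exist elements $a_1,\dots,a_q\in H^*(M;A)$ with (1) $\dim a_i>0$ for all $i$; (2) the product $a_1\cdots a_q$ is non-zero; (3) $\dim(a_1\cdots a_q)\le m-p$. (The value $q=0$, the empty product being $1$, is allowed.) *)

theory Defs
  imports "HOL-Homology.Homology" "HOL-Algebra.QuotRing" "HOL-Algebra.Subrings"
begin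

section \<open>Singular cochains and the cup product\<close>

text \<open>
  An inhomogeneous singular cochain assigns to each degree \<open>k\<close> a coefficient-valued function on
  functions \<open>(nat \<Rightarrow> real) \<Rightarrow> 'a\<close>; it is required to vanish on everything that is not a singular
  \<open>k\<close>-simplex, and in all but finitely many degrees. As singular \<open>k\<close>-simplices form a basis of the
  chain group, such cochains are the direct sum over \<open>k\<close> of \<open>Hom(C\<^sub>k(X), A)\<close>.
\<close>

type_synonym ('a, 'k) cochain = "nat \<Rightarrow> ((nat \<Rightarrow> real) \<Rightarrow> 'a) \<Rightarrow> 'k"

definition cochains :: "'a topology \<Rightarrow> ('a, 'k::comm_ring_1) cochain set" where
  "cochains X = {\<phi>. (\<forall>k \<sigma>. \<not> singular_simplex k X \<sigma> \<longrightarrow> \<phi> k \<sigma> = 0) \<and>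
                    finite {k. \<exists>\<sigma>. \<phi> k \<sigma> \<noteq> 0}}"

fun coboundary :: "'a topology \<Rightarrow> ('a, 'k::comm_ring_1) cochain \<Rightarrow> ('a, 'k) cochain" where
  "coboundary X \<phi> 0 \<sigma> = 0"
| "coboundary X \<phi> (Suc k) \<sigma> =
     (if singular_simplex (Suc k) X \<sigma>
      then \<Sum>j\<le>Suc k. (-1) ^ j * \<phi> k (singular_face (Suc k) j \<sigma>) else 0)"

text \<open>
  The front \<open>i\<close>-face is spanned by the vertices \<open>0, \<dots>, i\<close> of a simplex, and the back \<open>l\<close>-face of
  an \<open>(i + l)\<close>-simplex by its vertices \<open>i, \<dots>, i + l\<close>. Points of the standard \<open>i\<close>-simplex are
  sequences that vanish beyond index \<open>i\<close>, so the inclusion as a front face is the identity.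
\<close>

definition front_face :: "nat \<Rightarrow> ((nat \<Rightarrow> real) \<Rightarrow> 'a) \<Rightarrow> (nat \<Rightarrow> real) \<Rightarrow> 'a" where
  "front_face i \<sigma> = restrict \<sigma> (standard_simplex i)"

definition shift_coords :: "nat \<Rightarrow> (nat \<Rightarrow> real) \<Rightarrow> nat \<Rightarrow> real" where
  "shift_coords i x = (\<lambda>j. if j < i then 0 else x (j - i))"

definition back_face :: "nat \<Rightarrow> nat \<Rightarrow> ((nat \<Rightarrow> real) \<Rightarrow> 'a) \<Rightarrow> (nat \<Rightarrow> real) \<Rightarrow> 'a" where
  "back_face i l \<sigma> = restrict (\<sigma> \<circ> shift_coords i) (standard_simplex l)"

definition cup :: "'a topology \<Rightarrow> ('a, 'k::comm_ring_1) cochain \<Rightarrow> ('a, 'k) cochain \<Rightarrow> ('a, 'k) cochain"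
  where "cup X \<phi> \<psi> = (\<lambda>k \<sigma>. if singular_simplex k X \<sigma>
           then \<Sum>i\<le>k. \<phi> i (front_face i \<sigma>) * \<psi> (k - i) (back_face i (k - i) \<sigma>) else 0)"

definition cochain_ring :: "'a topology \<Rightarrow> ('a, 'k::comm_ring_1) cochain ring" where
  "cochain_ring X =
     \<lparr>carrier = cochains X,
      mult = cup X,
      one = (\<lambda>k \<sigma>. if k = 0 \<and> singular_simplex 0 X \<sigma> then 1 else 0),
      zero = (\<lambda>k \<sigma>. 0),
      add = (\<lambda>\<phi> \<psi> k \<sigma>. \<phi> k \<sigma> + \<psi> k \<sigma>)\<rparr>"

section \<open>The cohomology ring\<close>

definition cocycles :: "'a topology \<Rightarrow> ('a, 'k::comm_ring_1) cochain set" where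
  "cocycles X = {\<phi> \<in> cochains X. coboundary X \<phi> = (\<lambda>k \<sigma>. 0)}"

definition coboundaries :: "'a topology \<Rightarrow> ('a, 'k::comm_ring_1) cochain set" where
  "coboundaries X = coboundary X ` cochains X"

definition cocycle_ring :: "'a topology \<Rightarrow> ('a, 'k::comm_ring_1) cochain ring" where
  "cocycle_ring X = (cochain_ring X)\<lparr>carrier := cocycles X\<rparr>"

definition cohomology_ring :: "'a topology \<Rightarrow> ('a, 'k::comm_ring_1) cochain set ring" where
  "cohomology_ring X = cocycle_ring X Quot coboundaries X"

text \<open>The homogeneous part of degree \<open>d\<close> of the cohomology ring: the classes of dimension \<open>d\<close>.\<close>

definition cohomology_part :: "nat \<Rightarrow> 'a topology \<Rightarrow> ('a, 'k::comm_ring_1) cochain set set" where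
  "cohomology_part d X =
     {coboundaries X +>\<^bsub>cocycle_ring X\<^esub> \<phi> |\<phi>. \<phi> \<in> cocycles X \<and> (\<forall>k \<sigma>. k \<noteq> d \<longrightarrow> \<phi> k \<sigma> = 0)}"

section \<open>The p-length and the torus\<close>

text \<open>
  \<open>m\<close> is the dimension of the manifold \<open>M\<close>, and the first argument fixes the coefficient ring.
  Orientability is not needed for the definition to make sense. As the product is non-zero, its
  dimension \<open>d\<close> is unique (\<open>cohomology_part_unique\<close>), and it is the sum of the dimensions of the
  factors (\<open>cohomology_part_mult\<close>), so that \<open>q \<le> d \<le> m\<close> is bounded. The inequality \<open>d + p \<le> m\<close>
  is \<open>d \<le> m - p\<close> without truncated subtraction. The empty product (\<open>q = 0\<close>) is the unit.
\<close>

definition p_length :: "'k::comm_ring_1 itself \<Rightarrow> nat \<Rightarrow> nat \<Rightarrow> 'a topology \<Rightarrow> nat" where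
  "p_length A m p M =
     (let H = (cohomology_ring M :: ('a, 'k) cochain set ring) in
      GREATEST q. \<exists>as. length as = q \<and>
        (\<forall>a\<in>set as. \<exists>d>0. a \<in> cohomology_part d M) \<and>
        foldr (\<otimes>\<^bsub>H\<^esub>) as \<one>\<^bsub>H\<^esub> \<noteq> \<zero>\<^bsub>H\<^esub> \<and>
        (\<exists>d. d + p \<le> m \<and> foldr (\<otimes>\<^bsub>H\<^esub>) as \<one>\<^bsub>H\<^esub> \<in> cohomology_part d M))"

definition torus :: "nat \<Rightarrow> (nat \<Rightarrow> complex) topology" where
  "torus n = product_topology (\<lambda>_. top_of_set (sphere 0 1)) {..<n}"

section \<open>Well-definedness of the ring structure\<close>

lemma shift_coords_simplex:
  assumes "x \<in> standard_simplex l" shows "shift_coords i x \<in> standard_simplex (i + l)"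
proof -
  have "(\<Sum>j\<le>i+l. shift_coords i x j) = (\<Sum>j\<in>{i..i+l}. shift_coords i x j)"
    by (rule sum.mono_neutral_right) (auto simp: shift_coords_def)
  also have "\<dots> = (\<Sum>j\<le>l. x j)"
    by (rule sum.reindex_bij_witness[of _ "\<lambda>j. j + i" "\<lambda>j. j - i"]) (auto simp: shift_coords_def)
  finally show ?thesis
    using assms by (auto simp: standard_simplex_def shift_coords_def)
qed

lemma simplical_face_simplex:
  "x \<in> standard_simplex i \<Longrightarrow> j \<le> Suc i \<Longrightarrow> simplical_face j x \<in> standard_simplex (Suc i)"
  using simplical_face_in_standard_simplex[of "Suc i" j x] by simp

lemma singular_simplex_front_face:
  assumes "singular_simplex k X \<sigma>" "i \<le> k"
  shows "singular_simplex i X (front_face i \<sigma>)"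
proof -
  have "continuous_map (subtopology (powertop_real UNIV) (standard_simplex i)) X \<sigma>"
    using assms standard_simplex_mono[OF assms(2)]
    by (auto simp: singular_simplex_def intro: continuous_map_from_subtopology_mono)
  then show ?thesis
    by (simp add: singular_simplex_def front_face_def)
qed

lemma singular_simplex_back_face:
  assumes "singular_simplex (i + l) X \<sigma>"
  shows "singular_simplex l X (back_face i l \<sigma>)"
proof -
  have "continuous_map (powertop_real UNIV) euclideanreal
           (\<lambda>x. shift_coords i x j)" for j
    by (auto simp: shift_coords_def intro: continuous_map_product_projection)
  then have "continuous_map (subtopology (powertop_real UNIV) (standard_simplex l))
               (powertop_real UNIV) (shift_coords i)"
    by (simp add: continuous_map_componentwise continuous_map_from_subtopology)
  then have "continuous_map (subtopology (powertop_real UNIV) (standard_simplex l))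
               (subtopology (powertop_real UNIV) (standard_simplex (i + l))) (shift_coords i)"
    by (auto simp: continuous_map_in_subtopology shift_coords_simplex)
  then show ?thesis
    using assms by (auto simp: singular_simplex_def back_face_def intro: continuous_map_compose)
qed

lemma singular_simplex_face:
  "singular_simplex (Suc k) X \<sigma> \<Longrightarrow> j \<le> Suc k \<Longrightarrow> singular_simplex k X (singular_face (Suc k) j \<sigma>)"
  using singular_simplex_singular_face[of "Suc k" X \<sigma> j] by simp

lemma front_front: "i \<le> j \<Longrightarrow> front_face i (front_face j \<sigma>) = front_face i \<sigma>"
  using standard_simplex_mono[of i j] by (auto simp: front_face_def restrict_def fun_eq_iff)

lemma back_back: "back_face j l (back_face i (j + l) \<sigma>) = back_face (i + j) l \<sigma>"
  using shift_coords_simplex[of _ l j]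
  by (auto simp: back_face_def fun_eq_iff restrict_def shift_coords_def intro!: arg_cong[of _ _ \<sigma>])

lemma front_back: "front_face j (back_face i l \<sigma>) = back_face i j (front_face (i + j) \<sigma>)" if "j \<le> l"
  using shift_coords_simplex[of _ j i] standard_simplex_mono[OF that]
  by (auto simp: back_face_def front_face_def fun_eq_iff restrict_def)

lemma front_full: "singular_simplex k X \<sigma> \<Longrightarrow> front_face k \<sigma> = \<sigma>"
  by (auto simp: front_face_def singular_simplex_def extensional_restrict)

lemma back_full: "singular_simplex k X \<sigma> \<Longrightarrow> back_face 0 k \<sigma> = \<sigma>"
  by (auto simp: back_face_def shift_coords_def singular_simplex_def extensional_def fun_eq_iff)

lemma front_sface_le:
  assumes "j \<le> i" "i \<le> n"
  shows "front_face i (singular_face (Suc n) j \<sigma>) = singular_face (Suc i) j (front_face (Suc i) \<sigma>)"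
  using assms standard_simplex_mono[of i n] simplical_face_simplex[of _ i j]
  by (auto simp: front_face_def singular_face_def fun_eq_iff restrict_def)

lemma front_sface_gt:
  assumes "i < j" "i \<le> n"
  shows "front_face i (singular_face (Suc n) j \<sigma>) = front_face i \<sigma>"
proof -
  have "simplical_face j x = x" if "x \<in> standard_simplex i" for x
    using that assms by (auto simp: simplical_face_def standard_simplex_def fun_eq_iff)
  then show ?thesis
    using assms standard_simplex_mono[of i n]
    by (intro ext) (auto simp: front_face_def singular_face_def restrict_def)
qed

lemma back_sface_le:
  assumes "j \<le> i"
  shows "back_face i l (singular_face (Suc (i + l)) j \<sigma>) = back_face (Suc i) l \<sigma>"
proof -
  have "simplical_face j (shift_coords i x) = shift_coords (Suc i) x" for x
    using assms by (auto simp: simplical_face_def shift_coords_def fun_eq_iff)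
  then show ?thesis
    using shift_coords_simplex[of _ l i]
    by (intro ext) (auto simp: back_face_def singular_face_def restrict_def)
qed

lemma back_sface_ge:
  "back_face i l (singular_face (Suc (i + l)) (i + j) \<sigma>)
     = singular_face (Suc l) j (back_face i (Suc l) \<sigma>)" if "j \<le> Suc l"
proof -
  have "simplical_face (i + j) (shift_coords i x) = shift_coords i (simplical_face j x)" for x
    by (auto simp: simplical_face_def shift_coords_def fun_eq_iff)
  then show ?thesis
    using shift_coords_simplex[of _ l i] simplical_face_simplex[of _ l j] that
    by (intro ext) (auto simp: back_face_def singular_face_def restrict_def)
qed

definition alternate :: "('a, 'k::comm_ring_1) cochain \<Rightarrow> ('a, 'k) cochain" where
  "alternate \<phi> = (\<lambda>k \<sigma>. (-1) ^ k * \<phi> k \<sigma>)"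

lemma cup_leibniz:
  "coboundary X (cup X \<phi> \<psi>) k \<sigma>
     = cup X (coboundary X \<phi>) \<psi> k \<sigma> + cup X (alternate \<phi>) (coboundary X \<psi>) k \<sigma>"
proof (cases k)
  case 0
  then show ?thesis by (simp add: cup_def)
next
  case (Suc n)
  show ?thesis
  proof (cases "singular_simplex (Suc n) X \<sigma>")
    case False
    then show ?thesis by (simp add: Suc cup_def)
  next
    case True
    define F where "F = (\<lambda>i j. \<phi> i (front_face i (singular_face (Suc n) j \<sigma>)) *
                               \<psi> (n - i) (back_face i (n - i) (singular_face (Suc n) j \<sigma>)))"
    define L where "L = (\<lambda>i. coboundary X \<phi> (Suc i) (front_face (Suc i) \<sigma>)
                              * \<psi> (n - i) (back_face (Suc i) (n - i) \<sigma>))"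
    define R where "R = (\<lambda>i. (-1) ^ i * \<phi> i (front_face i \<sigma>)
                              * coboundary X \<psi> (Suc (n - i)) (back_face i (Suc (n - i)) \<sigma>))"
    have key: "(\<Sum>j\<le>Suc n. (-1) ^ j * F i j) = L i + R i" if i: "i \<le> n" for i
    proof -
      define c where "c = \<phi> i (front_face i \<sigma>) * \<psi> (n - i) (back_face (Suc i) (n - i) \<sigma>)"
      have ssf: "singular_simplex (Suc i) X (front_face (Suc i) \<sigma>)"
        by (rule singular_simplex_front_face[OF True]) (use i in simp)
      have ssb: "singular_simplex (Suc (n - i)) X (back_face i (Suc (n - i)) \<sigma>)"
        by (rule singular_simplex_back_face) (use True i in simp)
      have n: "Suc (i + (n - i)) = Suc n"
        using i by simp
      have "L i = (\<Sum>j\<le>i. (-1) ^ j * F i j) + (-1) ^ Suc i * c"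
      proof -
        have top: "singular_face (Suc i) (Suc i) (front_face (Suc i) \<sigma>) = front_face i \<sigma>"
          using front_sface_gt[of i "Suc i" i "front_face (Suc i) \<sigma>"]
            front_full[OF singular_simplex_face[OF ssf]] by (simp add: front_front)
        have "F i j = \<phi> i (singular_face (Suc i) j (front_face (Suc i) \<sigma>)) *
                \<psi> (n - i) (back_face (Suc i) (n - i) \<sigma>)" if "j \<le> i" for j
          using that i back_sface_le[of j i "n - i" \<sigma>] by (simp add: F_def front_sface_le n)
        then show ?thesis
          using ssf by (simp add: L_def c_def top left_diff_distrib sum_distrib_right mult.assoc)
      qed
      moreover have "R i = (\<Sum>j=Suc i..Suc n. (-1) ^ j * F i j) + (-1) ^ i * c"
      proof -
        let ?G = "\<lambda>j. (-1) ^ (i + j) * (\<phi> i (front_face i \<sigma>) *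
                   \<psi> (n - i) (singular_face (Suc (n - i)) j (back_face i (Suc (n - i)) \<sigma>)))"
        have "R i = (\<Sum>j\<le>Suc (n - i). ?G j)"
          using ssb unfolding R_def coboundary.simps
          by (simp add: sum_distrib_left power_add algebra_simps del: sum.atMost_Suc)
        also have "\<dots> = ?G 0 + (\<Sum>j\<le>n - i. ?G (Suc j))"
          by (rule sum.atMost_Suc_shift)
        also have "singular_face (Suc (n - i)) 0 (back_face i (Suc (n - i)) \<sigma>)
                     = back_face (Suc i) (n - i) \<sigma>"
          using back_sface_ge[of 0 "n - i" i \<sigma>] back_sface_le[of i i "n - i" \<sigma>] by simp
        also have "(\<Sum>j\<le>n - i. ?G (Suc j)) = (\<Sum>j=Suc i..Suc n. (-1) ^ j * F i j)"
        proof (rule sum.reindex_bij_witness[of _ "\<lambda>j. j - Suc i" "\<lambda>j. Suc (i + j)"])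
          fix j assume "j \<in> {..n - i}"
          then show "(-1) ^ Suc (i + j) * F i (Suc (i + j)) = ?G (Suc j)"
            using i back_sface_ge[of "Suc j" "n - i" i \<sigma>]
            by (simp add: F_def front_sface_gt n)
        qed (use i in auto)
        finally show ?thesis
          by (simp add: c_def)
      qed
      moreover have "(\<Sum>j\<le>Suc n. (-1) ^ j * F i j)
          = (\<Sum>j\<le>i. (-1) ^ j * F i j) + (\<Sum>j=Suc i..Suc n. (-1) ^ j * F i j)"
        using i sum.union_disjoint[of "{..i}" "{Suc i..Suc n}" "\<lambda>j. (-1) ^ j * F i j"]
          ivl_disj_un_one(3)[of i "Suc n"]
        by (simp add: atLeastSucAtMost_greaterThanAtMost ivl_disj_int del: sum.cl_ivl_Suc)
      ultimately show ?thesis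
        by simp
    qed
    have "coboundary X (cup X \<phi> \<psi>) k \<sigma> = (\<Sum>j\<le>Suc n. (-1) ^ j * (\<Sum>i\<le>n. F i j))"
      using True singular_simplex_face[OF True]
      by (auto simp: Suc cup_def F_def simp del: sum.atMost_Suc intro!: sum.cong)
    also have "\<dots> = (\<Sum>i\<le>n. \<Sum>j\<le>Suc n. (-1) ^ j * F i j)"
      by (subst sum.swap) (simp add: sum_distrib_left)
    also have "\<dots> = (\<Sum>i\<le>n. L i) + (\<Sum>i\<le>n. R i)"
      by (simp add: key sum.distrib del: sum.atMost_Suc)
    also have "(\<Sum>i\<le>n. L i) = cup X (coboundary X \<phi>) \<psi> k \<sigma>"
      using True unfolding cup_def Suc by (subst sum.atMost_Suc_shift) (simp add: L_def)
    also have "(\<Sum>i\<le>n. R i) = cup X (alternate \<phi>) (coboundary X \<psi>) k \<sigma>"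
      using True by (simp add: cup_def Suc R_def alternate_def Suc_diff_le)
    finally show ?thesis .
  qed
qed

lemma cup_assoc: "cup X (cup X \<phi> \<psi>) \<xi> = cup X \<phi> (cup X \<psi> \<xi>)"
proof (intro ext)
  fix k \<sigma>
  show "cup X (cup X \<phi> \<psi>) \<xi> k \<sigma> = cup X \<phi> (cup X \<psi> \<xi>) k \<sigma>"
  proof (cases "singular_simplex k X \<sigma>")
    case True
    let ?T = "\<lambda>i j l. \<phi> i (front_face i \<sigma>) * \<psi> j (back_face i j (front_face (i + j) \<sigma>))
                      * \<xi> l (back_face (i + j) l \<sigma>)"
    have "cup X (cup X \<phi> \<psi>) \<xi> k \<sigma> = (\<Sum>m\<le>k. \<Sum>i\<le>m. ?T i (m - i) (k - m))"
      using True singular_simplex_front_face[OF True]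
      by (auto simp: cup_def sum_distrib_right front_front intro!: sum.cong)
    also have "\<dots> = (\<Sum>i\<le>k. \<Sum>j\<le>k - i. ?T i j (k - i - j))"
      unfolding sum.Sigma[OF finite_atMost ballI[OF finite_atMost]] split_def
      by (rule sum.reindex_bij_witness[of _ "\<lambda>(i, j). (i + j, i)" "\<lambda>(m, i). (i, m - i)"]) auto
    also have "\<dots> = cup X \<phi> (cup X \<psi> \<xi>) k \<sigma>"
    proof -
      have "cup X \<psi> \<xi> (k - i) (back_face i (k - i) \<sigma>)
          = (\<Sum>j\<le>k - i. \<psi> j (back_face i j (front_face (i + j) \<sigma>))
                        * \<xi> (k - i - j) (back_face (i + j) (k - i - j) \<sigma>))" if "i \<le> k" for i
      proof -
        have "singular_simplex (k - i) X (back_face i (k - i) \<sigma>)"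
          by (rule singular_simplex_back_face) (use True that in simp)
        moreover have bb: "back_face j (k - (i + j)) (back_face i (k - i) \<sigma>)
            = back_face (i + j) (k - (i + j)) \<sigma>" if "j \<le> k - i" for j
          using back_back[of j "k - (i + j)" i \<sigma>] that \<open>i \<le> k\<close> by simp
        ultimately show ?thesis
          using bb by (auto simp: cup_def front_back intro!: sum.cong)
      qed
      then show ?thesis
        using True
        by (simp add: cup_def[of X \<phi> "cup X \<psi> \<xi>"] sum_distrib_left mult.assoc)
    qed
    finally show ?thesis .
  qed (simp add: cup_def)
qed

lemma cochains_D: "\<phi> \<in> cochains X \<Longrightarrow> \<not> singular_simplex k X \<sigma> \<Longrightarrow> \<phi> k \<sigma> = 0"
  by (simp add: cochains_def)

lemma cochains_I:
  assumes "\<And>k \<sigma>. \<not> singular_simplex k X \<sigma> \<Longrightarrow> \<phi> k \<sigma> = 0"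
    and "\<And>k \<sigma>. \<phi> k \<sigma> \<noteq> 0 \<Longrightarrow> k \<in> S" and "finite S"
  shows "\<phi> \<in> cochains X"
  using assms by (auto simp: cochains_def intro: finite_subset[of _ S])

lemma cochains_finite: "\<phi> \<in> cochains X \<Longrightarrow> finite {k. \<exists>\<sigma>. \<phi> k \<sigma> \<noteq> 0}"
  by (simp add: cochains_def)

lemma cochains_add:
  assumes "\<phi> \<in> cochains X" "\<psi> \<in> cochains X"
  shows "(\<lambda>k \<sigma>. \<phi> k \<sigma> + \<psi> k \<sigma>) \<in> cochains X"
  by (rule cochains_I[of _ _ "{k. \<exists>\<sigma>. \<phi> k \<sigma> \<noteq> 0} \<union> {k. \<exists>\<sigma>. \<psi> k \<sigma> \<noteq> 0}"])
    (use assms in \<open>auto simp: cochains_D cochains_finite\<close>)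

lemma cochains_uminus: "\<phi> \<in> cochains X \<Longrightarrow> (\<lambda>k \<sigma>. - \<phi> k \<sigma>) \<in> cochains X"
  by (simp add: cochains_def)

lemma cochains_alternate: "\<phi> \<in> cochains X \<Longrightarrow> alternate \<phi> \<in> cochains X"
  by (rule cochains_I[of _ _ "{k. \<exists>\<sigma>. \<phi> k \<sigma> \<noteq> 0}"])
    (auto simp: alternate_def cochains_D cochains_finite intro!: exI dest: mult_not_zero)

lemma cochains_zero: "(\<lambda>k \<sigma>. 0) \<in> cochains X"
  by (simp add: cochains_def)

lemma cochains_one: "(\<lambda>k \<sigma>. if k = 0 \<and> singular_simplex 0 X \<sigma> then 1 else 0) \<in> cochains X"
  by (rule cochains_I[of _ _ "{0}"]) (auto split: if_splits)

lemma cochains_cup: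
  assumes "\<phi> \<in> cochains X" "\<psi> \<in> cochains X"
  shows "cup X \<phi> \<psi> \<in> cochains X"
proof (rule cochains_I)
  let ?S = "\<lambda>\<phi>. {k. \<exists>\<sigma>. \<phi> k \<sigma> \<noteq> 0}"
  show "finite ((\<lambda>(i, j). i + j) ` (?S \<phi> \<times> ?S \<psi>))"
    using assms by (simp add: cochains_finite)
  fix k \<sigma> assume nz: "cup X \<phi> \<psi> k \<sigma> \<noteq> 0"
  obtain i where i: "i \<le> k" "\<phi> i (front_face i \<sigma>) * \<psi> (k - i) (back_face i (k - i) \<sigma>) \<noteq> 0"
  proof -
    have "(\<Sum>i\<le>k. \<phi> i (front_face i \<sigma>) * \<psi> (k - i) (back_face i (k - i) \<sigma>)) \<noteq> 0"
      using nz by (auto simp: cup_def split: if_splits)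
    then show ?thesis
      using that by (metis (no_types, lifting) atMost_iff sum.not_neutral_contains_not_neutral)
  qed
  then have "i \<in> ?S \<phi>" "k - i \<in> ?S \<psi>"
    by (auto dest: mult_not_zero)
  then show "k \<in> (\<lambda>(i, j). i + j) ` (?S \<phi> \<times> ?S \<psi>)"
    using i(1) by (intro image_eqI[of _ _ "(i, k - i)"]) auto
qed (simp add: cup_def)

lemma cochains_coboundary:
  assumes "\<phi> \<in> cochains X"
  shows "coboundary X \<phi> \<in> cochains X"
proof (rule cochains_I)
  show "finite (Suc ` {k. \<exists>\<sigma>. \<phi> k \<sigma> \<noteq> 0})"
    using assms by (simp add: cochains_finite)
  fix k \<sigma>
  show "coboundary X \<phi> k \<sigma> = 0" if "\<not> singular_simplex k X \<sigma>"
    using that by (cases k) auto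
  assume nz: "coboundary X \<phi> k \<sigma> \<noteq> 0"
  then obtain n where k: "k = Suc n" by (cases k) auto
  have "\<exists>\<tau>. \<phi> n \<tau> \<noteq> 0"
  proof (rule ccontr)
    assume "\<not> (\<exists>\<tau>. \<phi> n \<tau> \<noteq> 0)"
    then have "\<phi> n = (\<lambda>_. 0)" by auto
    then show False using nz by (simp add: k split: if_splits del: sum.atMost_Suc)
  qed
  then show "k \<in> Suc ` {k. \<exists>\<sigma>. \<phi> k \<sigma> \<noteq> 0}" using k by blast
qed

lemma cup_one_left:
  assumes "\<phi> \<in> cochains X"
  shows "cup X (\<lambda>k \<sigma>. if k = 0 \<and> singular_simplex 0 X \<sigma> then 1 else 0) \<phi> = \<phi>"
proof (intro ext)
  fix k \<sigma>
  show "cup X (\<lambda>k \<sigma>. if k = 0 \<and> singular_simplex 0 X \<sigma> then 1 else 0) \<phi> k \<sigma> = \<phi> k \<sigma>"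
    using singular_simplex_front_face[of k X \<sigma> 0] back_full[of k X \<sigma>] cochains_D[OF assms, of k \<sigma>]
    by (simp add: cup_def, intro impI trans[OF sum.mono_neutral_right[of "{..k}" "{0}"]]) auto
qed

lemma cup_one_right:
  assumes "\<phi> \<in> cochains X"
  shows "cup X \<phi> (\<lambda>k \<sigma>. if k = 0 \<and> singular_simplex 0 X \<sigma> then 1 else 0) = \<phi>"
proof (intro ext)
  fix k \<sigma>
  show "cup X \<phi> (\<lambda>k \<sigma>. if k = 0 \<and> singular_simplex 0 X \<sigma> then 1 else 0) k \<sigma> = \<phi> k \<sigma>"
    using singular_simplex_back_face[of k 0 X \<sigma>] front_full[of k X \<sigma>] cochains_D[OF assms, of k \<sigma>]
    by (simp add: cup_def, intro impI trans[OF sum.mono_neutral_right[of "{..k}" "{k}"]]) auto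
qed

lemma cup_add_left:
  "cup X (\<lambda>k \<sigma>. \<phi> k \<sigma> + \<psi> k \<sigma>) \<xi> = (\<lambda>k \<sigma>. cup X \<phi> \<xi> k \<sigma> + cup X \<psi> \<xi> k \<sigma>)"
  by (auto simp: cup_def fun_eq_iff distrib_right sum.distrib)

lemma cup_add_right:
  "cup X \<xi> (\<lambda>k \<sigma>. \<phi> k \<sigma> + \<psi> k \<sigma>) = (\<lambda>k \<sigma>. cup X \<xi> \<phi> k \<sigma> + cup X \<xi> \<psi> k \<sigma>)"
  by (auto simp: cup_def fun_eq_iff distrib_left sum.distrib)

lemma cup_zero [simp]: "cup X (\<lambda>k \<sigma>. 0) \<phi> = (\<lambda>k \<sigma>. 0)" "cup X \<phi> (\<lambda>k \<sigma>. 0) = (\<lambda>k \<sigma>. 0)"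
  by (auto simp: cup_def fun_eq_iff)

lemma coboundary_add:
  "coboundary X (\<lambda>k \<sigma>. \<phi> k \<sigma> + \<psi> k \<sigma>) = (\<lambda>k \<sigma>. coboundary X \<phi> k \<sigma> + coboundary X \<psi> k \<sigma>)"
proof (intro ext)
  show "coboundary X (\<lambda>k \<sigma>. \<phi> k \<sigma> + \<psi> k \<sigma>) k \<sigma> = coboundary X \<phi> k \<sigma> + coboundary X \<psi> k \<sigma>" for k \<sigma>
    by (cases k) (auto simp: distrib_left sum.distrib)
qed

lemma coboundary_uminus: "coboundary X (\<lambda>k \<sigma>. - \<phi> k \<sigma>) = (\<lambda>k \<sigma>. - coboundary X \<phi> k \<sigma>)"
proof (intro ext)
  show "coboundary X (\<lambda>k \<sigma>. - \<phi> k \<sigma>) k \<sigma> = - coboundary X \<phi> k \<sigma>" for k \<sigma>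
    by (cases k) (auto simp: sum_negf)
qed

lemma coboundary_zero: "coboundary X (\<lambda>k \<sigma>. 0) = (\<lambda>k \<sigma>. 0)"
proof (intro ext)
  show "coboundary X (\<lambda>k \<sigma>. 0) k \<sigma> = 0" for k \<sigma>
    by (cases k) auto
qed

lemma coboundary_alternate: "coboundary X (alternate \<phi>) = (\<lambda>k \<sigma>. - alternate (coboundary X \<phi>) k \<sigma>)"
proof (intro ext)
  show "coboundary X (alternate \<phi>) k \<sigma> = - alternate (coboundary X \<phi>) k \<sigma>" for k \<sigma>
    by (cases k) (auto simp: alternate_def sum_distrib_left algebra_simps)
qed

lemma alternate_alternate: "alternate (alternate \<phi>) = \<phi>"
proof (intro ext)
  show "alternate (alternate \<phi>) k \<sigma> = \<phi> k \<sigma>" for k \<sigma>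
    by (simp add: alternate_def flip: mult.assoc power_mult_distrib)
qed

lemma coboundary_cup_cocycles:
  assumes "coboundary X \<phi> = (\<lambda>k \<sigma>. 0)" "coboundary X \<psi> = (\<lambda>k \<sigma>. 0)"
  shows "coboundary X (cup X \<phi> \<psi>) = (\<lambda>k \<sigma>. 0)"
  by (intro ext) (simp add: cup_leibniz assms)

lemma cocycles_alternate: "\<phi> \<in> cocycles X \<Longrightarrow> alternate \<phi> \<in> cocycles X"
  by (simp add: cocycles_def cochains_alternate coboundary_alternate) (simp add: alternate_def)

text \<open>The coefficient-valued evaluation of a cochain on an integral chain.\<close>

definition eval_chain :: "('b \<Rightarrow> 'k::comm_ring_1) \<Rightarrow> ('b \<Rightarrow>\<^sub>0 int) \<Rightarrow> 'k" where
  "eval_chain f c = (\<Sum>\<sigma>\<in>Poly_Mapping.keys c. of_int (Poly_Mapping.lookup c \<sigma>) * f \<sigma>)"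

lemma eval_chain_superset:
  "finite S \<Longrightarrow> Poly_Mapping.keys c \<subseteq> S \<Longrightarrow>
     eval_chain f c = (\<Sum>\<sigma>\<in>S. of_int (Poly_Mapping.lookup c \<sigma>) * f \<sigma>)"
  unfolding eval_chain_def by (rule sum.mono_neutral_left) (auto simp: in_keys_iff)

lemma eval_chain_of [simp]: "eval_chain f (frag_of \<sigma>) = f \<sigma>"
  by (simp add: eval_chain_def)

lemma eval_chain_zero [simp]: "eval_chain f 0 = 0"
  by (simp add: eval_chain_def)

lemma eval_chain_cmul: "eval_chain f (frag_cmul a c) = of_int a * eval_chain f c"
  by (subst eval_chain_superset[of "Poly_Mapping.keys c"])
    (auto simp: keys_cmul eval_chain_def sum_distrib_left mult.assoc)

lemma eval_chain_add: "eval_chain f (c + d) = eval_chain f c + eval_chain f d"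
proof -
  let ?S = "Poly_Mapping.keys c \<union> Poly_Mapping.keys d"
  show ?thesis
    using keys_add[of c d] eval_chain_superset[of ?S "c + d" f] eval_chain_superset[of ?S c f]
      eval_chain_superset[of ?S d f]
    by (simp add: lookup_add distrib_right sum.distrib)
qed

lemma eval_chain_sum: "eval_chain f (sum g I) = (\<Sum>i\<in>I. eval_chain f (g i))"
  by (induction I rule: infinite_finite_induct) (auto simp: eval_chain_add)

lemma eval_coboundary:
  assumes "singular_chain (Suc k) X c"
  shows "eval_chain (coboundary X \<phi> (Suc k)) c = eval_chain (\<phi> k) (chain_boundary (Suc k) c)"
proof -
  have "eval_chain (\<phi> k) (chain_boundary (Suc k) c)
      = (\<Sum>\<sigma>\<in>Poly_Mapping.keys c. of_int (Poly_Mapping.lookup c \<sigma>) *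
          (\<Sum>j\<le>Suc k. (-1) ^ j * \<phi> k (singular_face (Suc k) j \<sigma>)))"
    by (simp add: chain_boundary_def frag_extend_def eval_chain_sum eval_chain_cmul del: sum.atMost_Suc)
  also have "\<dots> = eval_chain (coboundary X \<phi> (Suc k)) c"
    unfolding eval_chain_def using assms
    by (intro sum.cong) (auto simp: singular_chain_def simp del: sum.atMost_Suc)
  finally show ?thesis by simp
qed

lemma coboundary_coboundary: "coboundary X (coboundary X \<phi>) = (\<lambda>k \<sigma>. 0)"
proof (intro ext)
  fix k \<sigma>
  show "coboundary X (coboundary X \<phi>) k \<sigma> = 0"
  proof (cases "\<exists>n. k = Suc (Suc n) \<and> singular_simplex k X \<sigma>")
    case True
    then obtain n where k: "k = Suc (Suc n)" and s: "singular_chain (Suc (Suc n)) X (frag_of \<sigma>)"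
      by (auto simp: singular_chain_of)
    have "coboundary X (coboundary X \<phi>) k \<sigma>
        = eval_chain (\<phi> n) (chain_boundary (Suc n) (chain_boundary (Suc (Suc n)) (frag_of \<sigma>)))"
      using eval_coboundary[OF s, of "coboundary X \<phi>"]
        eval_coboundary[OF singular_chain_boundary_alt[OF s], of \<phi>] by (simp add: k)
    also have "\<dots> = 0"
      using chain_boundary_boundary_alt[OF s] by simp
    finally show ?thesis .
  next
    case False
    show ?thesis
    proof (cases k)
      case (Suc m)
      then show ?thesis using False by (cases m) auto
    qed simp
  qed
qed

lemma ring_cochain_ring: "ring (cochain_ring X)"
proof (rule ringI)
  show "abelian_group (cochain_ring X)"
  proof (rule abelian_groupI)
    fix \<phi> assume "\<phi> \<in> carrier (cochain_ring X)"
    then show "\<exists>\<psi>\<in>carrier (cochain_ring X). \<psi> \<oplus>\<^bsub>cochain_ring X\<^esub> \<phi> = \<zero>\<^bsub>cochain_ring X\<^esub>"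
      by (intro bexI[of _ "\<lambda>k \<sigma>. - \<phi> k \<sigma>"]) (auto simp: cochain_ring_def cochains_uminus)
  qed (auto simp: cochain_ring_def cochains_add cochains_zero add_ac)
  show "Group.monoid (cochain_ring X)"
    by (rule monoidI)
      (auto simp: cochain_ring_def cochains_cup cochains_one cup_assoc cup_one_left cup_one_right)
qed (auto simp: cochain_ring_def cup_add_left cup_add_right)

lemma cocycles_subring:
  fixes X :: "'a topology"
  shows "subring (cocycles X) (cochain_ring X :: ('a, 'b::comm_ring_1) cochain ring)"
proof (rule ring.subringI[OF ring_cochain_ring])
  interpret ring "cochain_ring X :: ('a, 'b) cochain ring" by (rule ring_cochain_ring)
  show "cocycles X \<subseteq> carrier (cochain_ring X)"
    by (auto simp: cocycles_def cochain_ring_def)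
  show "\<one>\<^bsub>cochain_ring X\<^esub> \<in> cocycles X"
  proof -
    have "coboundary X (\<lambda>k \<sigma>. if k = 0 \<and> singular_simplex 0 X \<sigma> then 1 else 0) k \<sigma> = 0" for k \<sigma>
    proof (cases k)
      case (Suc n)
      then show ?thesis
        using singular_simplex_face[of 0 X \<sigma>] by (cases n) auto
    qed simp
    then show ?thesis
      by (auto simp: cocycles_def cochain_ring_def cochains_one fun_eq_iff)
  qed
  fix \<phi> \<psi> :: "('a, 'b) cochain" assume a: "\<phi> \<in> cocycles X" "\<psi> \<in> cocycles X"
  then show "\<phi> \<oplus>\<^bsub>cochain_ring X\<^esub> \<psi> \<in> cocycles X"
    by (auto simp: cocycles_def cochain_ring_def coboundary_add cochains_add)
  show "\<phi> \<otimes>\<^bsub>cochain_ring X\<^esub> \<psi> \<in> cocycles X"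
    using a coboundary_cup_cocycles[of X \<phi> \<psi>] by (auto simp: cocycles_def cochain_ring_def cochains_cup)
  have "\<ominus>\<^bsub>cochain_ring X\<^esub> \<phi> = (\<lambda>k \<sigma>. - \<phi> k \<sigma>)"
    using a by (intro minus_equality) (auto simp: cocycles_def cochain_ring_def cochains_uminus)
  then show "\<ominus>\<^bsub>cochain_ring X\<^esub> \<phi> \<in> cocycles X"
    using a by (auto simp: cocycles_def coboundary_uminus cochains_uminus)
qed

lemma ring_cocycle_ring: "ring (cocycle_ring X)"
  unfolding cocycle_ring_def by (rule ring.subring_is_ring[OF ring_cochain_ring cocycles_subring])

lemma ideal_coboundaries:
  fixes X :: "'a topology"
  shows "ideal (coboundaries X) (cocycle_ring X :: ('a, 'b::comm_ring_1) cochain ring)"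
proof (rule idealI[OF ring_cocycle_ring])
  interpret ring "cocycle_ring X :: ('a, 'b) cochain ring" by (rule ring_cocycle_ring)
  have sub: "coboundaries X \<subseteq> carrier (cocycle_ring X :: ('a, 'b) cochain ring)"
    by (auto simp: coboundaries_def cocycle_ring_def cocycles_def cochains_coboundary
        coboundary_coboundary)
  show "subgroup (coboundaries X) (add_monoid (cocycle_ring X :: ('a, 'b) cochain ring))"
  proof (rule group.subgroupI[OF a_group])
    show "coboundaries X \<subseteq> carrier (add_monoid (cocycle_ring X :: ('a, 'b) cochain ring))"
      using sub by simp
    show "coboundaries X \<noteq> ({} :: ('a, 'b) cochain set)"
      using cochains_zero by (auto simp: coboundaries_def)
    fix \<phi> :: "('a, 'b) cochain" assume p: "\<phi> \<in> coboundaries X"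
    then obtain \<psi> where \<psi>: "\<psi> \<in> cochains X" "\<phi> = coboundary X \<psi>"
      by (auto simp: coboundaries_def)
    have m: "(\<lambda>k \<sigma>. - \<phi> k \<sigma>) = coboundary X (\<lambda>k \<sigma>. - \<psi> k \<sigma>)"
      using \<psi>(2) coboundary_uminus[of X \<psi>] by simp
    then have m': "(\<lambda>k \<sigma>. - \<phi> k \<sigma>) \<in> coboundaries X"
      using \<psi>(1) by (auto simp: coboundaries_def cochains_uminus)
    have "\<ominus>\<^bsub>cocycle_ring X\<^esub> \<phi> = (\<lambda>k \<sigma>. - \<phi> k \<sigma>)"
      using p m' sub by (intro minus_equality) (auto simp: cocycle_ring_def cochain_ring_def)
    then show "inv\<^bsub>add_monoid (cocycle_ring X)\<^esub> \<phi> \<in> coboundaries X"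
      using m' by (simp add: a_inv_def)
    fix \<psi>' :: "('a, 'b) cochain" assume "\<psi>' \<in> coboundaries X"
    then obtain \<xi> where "\<xi> \<in> cochains X" "\<psi>' = coboundary X \<xi>"
      by (auto simp: coboundaries_def)
    then show "\<phi> \<otimes>\<^bsub>add_monoid (cocycle_ring X)\<^esub> \<psi>' \<in> coboundaries X"
      using \<psi> cochains_add[of \<psi> X \<xi>] coboundary_add[of X \<psi> \<xi>, symmetric]
      by (auto simp: cocycle_ring_def cochain_ring_def coboundaries_def)
  qed
  fix \<phi> \<psi> :: "('a, 'b) cochain" assume "\<phi> \<in> coboundaries X" and \<psi>: "\<psi> \<in> carrier (cocycle_ring X)"
  then obtain \<xi> where \<xi>: "\<xi> \<in> cochains X" "\<phi> = coboundary X \<xi>"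
    by (auto simp: coboundaries_def)
  have \<psi>': "\<psi> \<in> cocycles X" using \<psi> by (simp add: cocycle_ring_def)
  have "cup X \<phi> \<psi> = coboundary X (cup X \<xi> \<psi>)"
    using \<psi>' by (intro ext) (simp add: \<xi>(2) cup_leibniz cocycles_def)
  then show "\<phi> \<otimes>\<^bsub>cocycle_ring X\<^esub> \<psi> \<in> coboundaries X"
    using \<xi>(1) \<psi>' cochains_cup by (auto simp: coboundaries_def cocycle_ring_def cochain_ring_def cocycles_def)
  have "cup X \<psi> \<phi> = coboundary X (cup X (alternate \<psi>) \<xi>)"
    using cocycles_alternate[OF \<psi>']
    by (intro ext) (simp add: \<xi>(2) cup_leibniz cocycles_def alternate_alternate)
  then show "\<psi> \<otimes>\<^bsub>cocycle_ring X\<^esub> \<phi> \<in> coboundaries X"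
    using \<xi>(1) cocycles_alternate[OF \<psi>'] cochains_cup
    by (auto simp: coboundaries_def cocycle_ring_def cochain_ring_def cocycles_def)
qed

lemma ring_cohomology_ring: "ring (cohomology_ring X)"
  unfolding cohomology_ring_def by (rule ideal.quotient_is_ring[OF ideal_coboundaries])

lemma cohomology_part_mult:
  fixes a b :: "('a, 'k::comm_ring_1) cochain set"
  assumes "a \<in> cohomology_part d X" "b \<in> cohomology_part e X"
  shows "a \<otimes>\<^bsub>cohomology_ring X\<^esub> b \<in> cohomology_part (d + e) X"
proof -
  interpret ideal "coboundaries X" "cocycle_ring X :: ('a, 'k) cochain ring"
    by (rule ideal_coboundaries)
  obtain \<phi> \<psi> where \<phi>: "\<phi> \<in> cocycles X" "\<And>k \<sigma>. k \<noteq> d \<Longrightarrow> \<phi> k \<sigma> = 0"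
      "a = coboundaries X +>\<^bsub>cocycle_ring X\<^esub> \<phi>"
    and \<psi>: "\<psi> \<in> cocycles X" "\<And>k \<sigma>. k \<noteq> e \<Longrightarrow> \<psi> k \<sigma> = 0"
      "b = coboundaries X +>\<^bsub>cocycle_ring X\<^esub> \<psi>"
    using assms by (auto simp: cohomology_part_def)
  have carr: "\<phi> \<in> carrier (cocycle_ring X)" "\<psi> \<in> carrier (cocycle_ring X)"
    using \<phi> \<psi> by (auto simp: cocycle_ring_def)
  have "a \<otimes>\<^bsub>cohomology_ring X\<^esub> b
      = coboundaries X +>\<^bsub>cocycle_ring X\<^esub> (\<phi> \<otimes>\<^bsub>cocycle_ring X\<^esub> \<psi>)"
    using rcoset_mult_add[OF carr] by (simp add: \<phi>(3) \<psi>(3) cohomology_ring_def FactRing_def)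
  moreover have "\<phi> \<otimes>\<^bsub>cocycle_ring X\<^esub> \<psi> = cup X \<phi> \<psi>"
    by (simp add: cocycle_ring_def cochain_ring_def)
  moreover have "cup X \<phi> \<psi> \<in> cocycles X"
    using m_closed[OF carr] by (simp add: cocycle_ring_def cochain_ring_def)
  moreover have "cup X \<phi> \<psi> k \<sigma> = 0" if "k \<noteq> d + e" for k \<sigma>
  proof -
    have "\<phi> i (front_face i \<sigma>) * \<psi> (k - i) (back_face i (k - i) \<sigma>) = 0" if "i \<le> k" for i
      using that \<open>k \<noteq> d + e\<close> \<phi>(2)[of i] \<psi>(2)[of "k - i"] by (cases "i = d") auto
    then show ?thesis by (simp add: cup_def)
  qed
  ultimately show ?thesis
    by (auto simp: cohomology_part_def)
qed

lemma cohomology_part_unique: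
  fixes a :: "('a, 'k::comm_ring_1) cochain set"
  assumes "a \<in> cohomology_part d X" "a \<in> cohomology_part e X" "a \<noteq> \<zero>\<^bsub>cohomology_ring X\<^esub>"
  shows "d = e"
proof (rule ccontr)
  assume "d \<noteq> e"
  interpret ideal "coboundaries X" "cocycle_ring X :: ('a, 'k) cochain ring"
    by (rule ideal_coboundaries)
  obtain \<phi> \<psi> where \<phi>: "\<phi> \<in> cocycles X" "\<And>k \<sigma>. k \<noteq> d \<Longrightarrow> \<phi> k \<sigma> = 0"
      "a = coboundaries X +>\<^bsub>cocycle_ring X\<^esub> \<phi>"
    and \<psi>: "\<psi> \<in> cocycles X" "\<And>k \<sigma>. k \<noteq> e \<Longrightarrow> \<psi> k \<sigma> = 0"
      "a = coboundaries X +>\<^bsub>cocycle_ring X\<^esub> \<psi>"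
    using assms(1,2) by (auto simp: cohomology_part_def)
  have carr: "\<phi> \<in> carrier (cocycle_ring X)" "\<psi> \<in> carrier (cocycle_ring X)"
    using \<phi> \<psi> by (auto simp: cocycle_ring_def)
  have "\<phi> \<in> coboundaries X +>\<^bsub>cocycle_ring X\<^esub> \<psi>"
    using a_rcos_self[OF carr(1)] \<phi>(3) \<psi>(3) by simp
  then obtain \<xi> where \<xi>: "\<xi> \<in> cochains X" "\<phi> = (\<lambda>k \<sigma>. coboundary X \<xi> k \<sigma> + \<psi> k \<sigma>)"
    by (auto simp: a_r_coset_def r_coset_def coboundaries_def cocycle_ring_def cochain_ring_def)
  define \<xi>' where "\<xi>' = (\<lambda>k \<sigma>. if Suc k = d then \<xi> k \<sigma> else 0)"
  have "\<xi>' \<in> cochains X"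
    by (rule cochains_I[of _ _ "{d - 1}"]) (auto simp: \<xi>'_def cochains_D[OF \<xi>(1)] split: if_splits)
  moreover have "\<phi> = coboundary X \<xi>'"
  proof (intro ext)
    fix k \<sigma>
    have "coboundary X \<xi>' k \<sigma> = (if k = d then coboundary X \<xi> k \<sigma> else 0)"
      by (cases k) (auto simp: \<xi>'_def)
    moreover have "\<phi> d \<sigma> = coboundary X \<xi> d \<sigma>"
      using fun_cong[OF fun_cong[OF \<xi>(2)], of d \<sigma>] \<psi>(2)[of d \<sigma>] \<open>d \<noteq> e\<close> by simp
    ultimately show "\<phi> k \<sigma> = coboundary X \<xi>' k \<sigma>"
      using \<phi>(2)[of k \<sigma>] by auto
  qed
  ultimately have "\<phi> \<in> coboundaries X"
    by (auto simp: coboundaries_def)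
  then have "a = \<zero>\<^bsub>cohomology_ring X\<^esub>"
    using a_coset_join2[OF carr(1)] a_rcos_const by (simp add: \<phi>(3) cohomology_ring_def FactRing_def)
  then show False
    using assms(3) by simp
qed

end

theory Submission
  imports Defs "HOL-Combinatorics.Permutations" "HOL-Analysis.Further_Topology"
begin

text \<open>
  Upper bound: the factors have positive dimension and the dimension of a non-zero homogeneous
  product is the sum of the dimensions of its factors, so a non-zero product of \<open>q\<close> factors has
  dimension at least \<open>q\<close>; if that dimension is at most \<open>n - p\<close>, then \<open>q \<le> n - p\<close>
  (\<open>length_le_degree\<close>). This holds on every space.

  Lower bound: for \<open>q \<le> n\<close> the first \<open>q\<close> angular classes \<open>\<theta>\<^sub>0, \<dots>, \<theta>\<^bsub>q-1\<^esub>\<close> of degree 1 have a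
  non-zero product. The cocycle \<open>\<theta>\<^sub>i\<close> sends a path \<open>\<sigma>\<close> to the integer \<open>\<lfloor>g(1)\<rfloor> - \<lfloor>g(0)\<rfloor>\<close>, where \<open>g\<close> is
  a real lift of the \<open>i\<close>-th coordinate of \<open>\<sigma>\<close>. Taking floors makes the value an integer also on paths
  that are not closed, so that the same formula works over \<open>\<int>\<close> and over \<open>\<real>\<close>. It does not depend on
  the lift (\<open>floor_change_lift\<close>), and it is a cocycle because the boundary of a 2-simplex lifts to a
  closed path (\<open>angular_cochain_cocycle\<close>).

  To see that \<open>\<theta>\<^sub>0 \<dots> \<theta>\<^bsub>q-1\<^esub>\<close> is not a coboundary, it is evaluated on the fundamental cycle of the
  coordinate torus \<open>T\<^sup>q\<close>: the unit cube is cut into the \<open>q!\<close> simplices on which the coordinates have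
  a given order, and these are summed with the sign of the corresponding permutation. Inner faces
  cancel in pairs that differ by a transposition (\<open>inner_face_transpose\<close>), and opposite sides of the
  cube become equal in the torus (\<open>outer_face_cycle\<close>), so coboundaries sum to zero
  (\<open>signed_sum_coboundary\<close>). By contrast, the cup product of the \<open>\<theta>\<^sub>i\<close> is the product of the values of
  \<open>\<theta>\<^sub>j\<close> on the \<open>j\<close>-th edge of the path through successive vertices; it is 1 on the simplex of the
  identity permutation and 0 on the others (\<open>angular_product_cube_simplex\<close>), so its sum is 1.
\<close>

section \<open>Products in the cohomology ring\<close>

lemma one_in_cohomology_part: "\<one>\<^bsub>cohomology_ring X\<^esub> \<in> cohomology_part 0 X"
proof -
  have "\<one>\<^bsub>cochain_ring X\<^esub> \<in> cocycles X"
    using subringE(3)[OF cocycles_subring] .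
  then show ?thesis
    unfolding cohomology_part_def
    by (auto simp: cohomology_ring_def FactRing_def cocycle_ring_def cochain_ring_def)
qed

lemma foldr_in_cohomology_part:
  assumes "\<And>a. a \<in> set as \<Longrightarrow> a \<in> cohomology_part (\<delta> a) X"
  shows "foldr (\<otimes>\<^bsub>cohomology_ring X\<^esub>) as \<one>\<^bsub>cohomology_ring X\<^esub>
           \<in> cohomology_part (sum_list (map \<delta> as)) X"
  using assms by (induction as) (auto intro: one_in_cohomology_part cohomology_part_mult)

text \<open>
  Each factor contributes at least 1 to the dimension of the product, and that dimension is
  determined by the product because the product is non-zero.
\<close>

lemma length_le_degree:
  fixes as :: "('a, 'k::comm_ring_1) cochain set list"
  assumes "\<forall>a\<in>set as. \<exists>d>0. a \<in> cohomology_part d X"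
    and "foldr (\<otimes>\<^bsub>cohomology_ring X\<^esub>) as \<one>\<^bsub>cohomology_ring X\<^esub> \<noteq> \<zero>\<^bsub>cohomology_ring X\<^esub>"
    and "foldr (\<otimes>\<^bsub>cohomology_ring X\<^esub>) as \<one>\<^bsub>cohomology_ring X\<^esub> \<in> cohomology_part d X"
  shows "length as \<le> d"
proof -
  obtain \<delta> where \<delta>: "\<And>a. a \<in> set as \<Longrightarrow> \<delta> a > 0 \<and> a \<in> cohomology_part (\<delta> a) X"
    using assms(1) by metis
  have "d = sum_list (map \<delta> as)"
    using cohomology_part_unique[OF assms(3) foldr_in_cohomology_part assms(2)] \<delta> by blast
  moreover have "length as \<le> sum_list (map \<delta> as)"
    using sum_list_mono[of as "\<lambda>_. 1" \<delta>] \<delta> by (simp add: sum_list_triv Suc_le_eq)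
  ultimately show ?thesis by simp
qed

lemma foldr_classes:
  fixes \<phi>s :: "('a, 'k::comm_ring_1) cochain list"
  assumes "set \<phi>s \<subseteq> cocycles X"
  shows "foldr (\<otimes>\<^bsub>cohomology_ring X\<^esub>) (map (\<lambda>\<phi>. coboundaries X +>\<^bsub>cocycle_ring X\<^esub> \<phi>) \<phi>s)
             \<one>\<^bsub>cohomology_ring X\<^esub>
           = coboundaries X +>\<^bsub>cocycle_ring X\<^esub> foldr (cup X) \<phi>s \<one>\<^bsub>cochain_ring X\<^esub>
         \<and> foldr (cup X) \<phi>s \<one>\<^bsub>cochain_ring X\<^esub> \<in> cocycles X"
  using assms
proof (induction \<phi>s)
  case Nil
  have "\<one>\<^bsub>cochain_ring X\<^esub> \<in> cocycles X"
    using subringE(3)[OF cocycles_subring] .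
  then show ?case
    by (auto simp: cohomology_ring_def FactRing_def cocycle_ring_def)
next
  case (Cons \<phi> \<phi>s)
  interpret ideal "coboundaries X" "cocycle_ring X :: ('a, 'k) cochain ring"
    by (rule ideal_coboundaries)
  let ?\<psi> = "foldr (cup X) \<phi>s \<one>\<^bsub>cochain_ring X\<^esub>"
  have carr: "\<phi> \<in> carrier (cocycle_ring X)" "?\<psi> \<in> carrier (cocycle_ring X)"
    using Cons by (auto simp: cocycle_ring_def)
  have mult: "\<phi> \<otimes>\<^bsub>cocycle_ring X\<^esub> ?\<psi> = cup X \<phi> ?\<psi>"
    by (simp add: cocycle_ring_def cochain_ring_def)
  then show ?case
    using rcoset_mult_add[OF carr] m_closed[OF carr] Cons
    by (auto simp: cohomology_ring_def FactRing_def cocycle_ring_def)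
qed

lemma class_eq_zeroD:
  fixes \<phi> :: "('a, 'k::comm_ring_1) cochain"
  assumes "\<phi> \<in> cocycles X"
    and "coboundaries X +>\<^bsub>cocycle_ring X\<^esub> \<phi> = \<zero>\<^bsub>cohomology_ring X\<^esub>"
  shows "\<phi> \<in> coboundaries X"
proof -
  interpret ideal "coboundaries X" "cocycle_ring X :: ('a, 'k) cochain ring"
    by (rule ideal_coboundaries)
  have "\<phi> \<in> coboundaries X +>\<^bsub>cocycle_ring X\<^esub> \<phi>"
    using assms(1) by (intro a_rcos_self) (simp add: cocycle_ring_def)
  then show ?thesis
    using assms(2) by (simp add: cohomology_ring_def FactRing_def)
qed

section \<open>Angular cocycles\<close>

definition is_lift :: "(real \<Rightarrow> complex) \<Rightarrow> (real \<Rightarrow> real) \<Rightarrow> bool" where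
  "is_lift p g \<longleftrightarrow> continuous_on {0..1} g \<and> (\<forall>t\<in>{0..1}. p t = cis (2 * pi * g t))"

definition floor_change :: "(real \<Rightarrow> complex) \<Rightarrow> int" where
  "floor_change p = (SOME m. \<exists>g. is_lift p g \<and> m = \<lfloor>g 1\<rfloor> - \<lfloor>g 0\<rfloor>)"

text \<open>
  Two lifts of a path differ by a continuous integer-valued function, hence by an integer constant,
  which cancels in the difference of the floors.
\<close>

lemma floor_change_lift:
  assumes "is_lift p g"
  shows "floor_change p = \<lfloor>g 1\<rfloor> - \<lfloor>g 0\<rfloor>"
proof -
  have "\<lfloor>h 1\<rfloor> - \<lfloor>h 0\<rfloor> = \<lfloor>g 1\<rfloor> - \<lfloor>g 0\<rfloor>" if h: "is_lift p h" for h
  proof -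
    let ?d = "\<lambda>t. h t - g t"
    have int: "?d t \<in> \<int>" if t: "t \<in> {0..1}" for t
    proof -
      have "cis (2 * pi * h t) = cis (2 * pi * g t)"
        using h assms t by (simp add: is_lift_def)
      then have "sin (2 * pi * h t) = sin (2 * pi * g t) \<and> cos (2 * pi * h t) = cos (2 * pi * g t)"
        by (simp add: complex_eq_iff)
      then obtain k :: int where "2 * pi * h t = 2 * pi * g t + 2 * pi * of_int k"
        unfolding sin_cos_eq_iff by blast
      then have "2 * pi * ?d t = 2 * pi * of_int k"
        by (simp add: algebra_simps)
      then show ?thesis by simp
    qed
    have "?d constant_on {0..1}"
    proof (rule continuous_discrete_range_constant)
      show "continuous_on {0..1} ?d"
        using h assms by (auto simp: is_lift_def intro: continuous_intros)
      have "1 \<le> norm (?d y - ?d x)" if "x \<in> {0..1}" "y \<in> {0..1}" "?d y \<noteq> ?d x" for x y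
        using Ints_nonzero_abs_ge1[of "?d y - ?d x"] int that by simp
      then show "\<exists>e>0. \<forall>y. y \<in> {0..1} \<and> ?d y \<noteq> ?d x \<longrightarrow> e \<le> norm (?d y - ?d x)"
        if "x \<in> {0..1}" for x
        using that by (intro exI[of _ 1]) auto
    qed simp
    then have "?d 1 = ?d 0"
      by (auto simp: constant_on_def)
    moreover obtain k where "?d 0 = of_int k"
      using int[of 0] by (auto elim: Ints_cases)
    ultimately have "h 1 = g 1 + of_int k" "h 0 = g 0 + of_int k"
      by simp_all
    then show ?thesis by simp
  qed
  then show ?thesis
    unfolding floor_change_def using assms by (intro some_equality; blast)
qed

definition edge_point :: "real \<Rightarrow> nat \<Rightarrow> real" where
  "edge_point t = (\<lambda>k. if k = 0 then 1 - t else if k = 1 then t else 0)"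

definition triangle_point :: "real \<times> real \<Rightarrow> nat \<Rightarrow> real" where
  "triangle_point = (\<lambda>(s, t) k. if k = 0 then 1 - s - t else if k = 1 then s
                                 else if k = 2 then t else 0)"

text \<open>
  The standard 2-simplex lives in a function space without a norm; this copy of it in the plane makes
  the existence of continuous logarithms available.
\<close>

definition plane_triangle :: "(real \<times> real) set" where
  "plane_triangle = {(s, t). 0 \<le> s \<and> 0 \<le> t \<and> s + t \<le> 1}"

lemma edge_point_in_simplex: "t \<in> {0..1} \<Longrightarrow> edge_point t \<in> standard_simplex 1"
  by (auto simp: edge_point_def standard_simplex_def)

lemma triangle_point_in_simplex: "z \<in> plane_triangle \<Longrightarrow> triangle_point z \<in> standard_simplex 2"
  by (auto simp: triangle_point_def plane_triangle_def standard_simplex_def eval_nat_numeral)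

text \<open>
  Convexity gives the contractibility on which lifting along the exponential map rests.
\<close>

lemma convex_triangle: "convex plane_triangle"
proof -
  have eq: "plane_triangle = {z. inner (-1, 0) z \<le> 0} \<inter> {z. inner (0, -1) z \<le> 0} \<inter> {z. inner (1, 1) z \<le> 1}"
    by (auto simp: plane_triangle_def)
  show ?thesis
    unfolding eq by (intro convex_Int convex_halfspace_le)
qed

text \<open>
  For the identity of the circle this represents the generator of the first cohomology group; in
  general it is the pullback of that cocycle along \<open>f\<close>.
\<close>

definition angular_cochain ::
    "'a topology \<Rightarrow> ('a \<Rightarrow> complex) \<Rightarrow> ('a, 'k::comm_ring_1) cochain" where
  "angular_cochain X f = (\<lambda>k \<sigma>. if k = 1 \<and> singular_simplex 1 X \<sigma>
     then of_int (floor_change (\<lambda>t. f (\<sigma> (edge_point t)))) else 0)"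

lemma lift_on_triangle:
  assumes f: "continuous_map X (top_of_set (sphere 0 1)) f" and \<sigma>: "singular_simplex 2 X \<sigma>"
  obtains g where "continuous_on plane_triangle g"
    "\<And>z. z \<in> plane_triangle \<Longrightarrow> f (\<sigma> (triangle_point z)) = cis (2 * pi * g z)"
proof -
  have "continuous_map (top_of_set plane_triangle) euclideanreal (\<lambda>z. triangle_point z k)" for k
    by (cases "k = 0"; cases "k = 1"; cases "k = 2")
      (auto simp: triangle_point_def case_prod_beta intro!: continuous_intros)
  then have "continuous_map (top_of_set plane_triangle)
      (subtopology (powertop_real UNIV) (standard_simplex 2)) triangle_point"
    by (auto simp: continuous_map_in_subtopology continuous_map_componentwise_UNIV
        triangle_point_in_simplex)
  then have "continuous_map (top_of_set plane_triangle) (top_of_set (sphere 0 1))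
               (f \<circ> (\<sigma> \<circ> triangle_point))"
    using f \<sigma> unfolding singular_simplex_def by (blast intro: continuous_map_compose)
  then have cont: "continuous_on plane_triangle (\<lambda>z. f (\<sigma> (triangle_point z)))"
    and norm1: "\<And>z. z \<in> plane_triangle \<Longrightarrow> norm (f (\<sigma> (triangle_point z))) = 1"
    by (auto simp: continuous_map_in_subtopology o_def continuous_map_iff_continuous)
  have nz: "\<And>z. z \<in> plane_triangle \<Longrightarrow> f (\<sigma> (triangle_point z)) \<noteq> 0"
    using norm1 by fastforce
  obtain h where h: "continuous_on plane_triangle h"
    "\<And>z. z \<in> plane_triangle \<Longrightarrow> f (\<sigma> (triangle_point z)) = exp (h z)"
    using continuous_logarithm_on_contractible[OF cont convex_imp_contractible[OF convex_triangle] nz]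
    by blast
  show ?thesis
  proof
    show "continuous_on plane_triangle (\<lambda>z. Im (h z) / (2 * pi))"
      by (intro continuous_intros h(1)) auto
    fix z assume z: "z \<in> plane_triangle"
    then have "Re (h z) = 0"
      using norm1[OF z] h(2)[OF z] by simp
    then show "f (\<sigma> (triangle_point z)) = cis (2 * pi * (Im (h z) / (2 * pi)))"
      using h(2)[OF z] by (simp add: exp_eq_polar)
  qed
qed

text \<open>
  On a 2-simplex, choose one lift \<open>g\<close> on the whole triangle. Its restrictions are lifts along the three
  edges, and the alternating sum of the floor differences telescopes at the vertices.
\<close>

lemma angular_cochain_cocycle:
  assumes f: "continuous_map X (top_of_set (sphere 0 1)) f"
  shows "(angular_cochain X f :: ('a, 'k::comm_ring_1) cochain) \<in> cocycles X"
proof -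
  let ?\<theta> = "angular_cochain X f :: ('a, 'k) cochain"
  have "?\<theta> \<in> cochains X"
    by (rule cochains_I[of _ _ "{1}"]) (auto simp: angular_cochain_def split: if_splits)
  moreover have "coboundary X ?\<theta> k \<sigma> = 0" for k \<sigma>
  proof (cases "k = 2 \<and> singular_simplex 2 X \<sigma>")
    case True
    then have \<sigma>: "singular_simplex 2 X \<sigma>" and k: "k = Suc 1" by auto
    obtain g where g: "continuous_on plane_triangle g"
      "\<And>z. z \<in> plane_triangle \<Longrightarrow> f (\<sigma> (triangle_point z)) = cis (2 * pi * g z)"
      using lift_on_triangle[OF f \<sigma>] by blast
    have edge: "?\<theta> 1 (singular_face (Suc 1) j \<sigma>)
                  = of_int (\<lfloor>g (e 1)\<rfloor> - \<lfloor>g (e 0)\<rfloor>)"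
      if j: "j \<le> 2" and e: "continuous_on {0..1} e" "e ` {0..1} \<subseteq> plane_triangle"
        "\<And>t. simplical_face j (edge_point t) = triangle_point (e t)" for j e
    proof -
      have "singular_simplex 1 X (singular_face (Suc 1) j \<sigma>)"
        using singular_simplex_face[of 1 X \<sigma> j] \<sigma> j by (simp add: numeral_2_eq_2)
      moreover have "is_lift (\<lambda>t. f (singular_face (Suc 1) j \<sigma> (edge_point t))) (g \<circ> e)"
        unfolding is_lift_def
      proof
        show "continuous_on {0..1} (g \<circ> e)"
          using e continuous_on_subset[OF g(1)] by (intro continuous_on_compose) auto
        show "\<forall>t\<in>{0..1}. f (singular_face (Suc 1) j \<sigma> (edge_point t)) = cis (2 * pi * (g \<circ> e) t)"
        proof
          fix t :: real assume t: "t \<in> {0..1}"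
          then have "e t \<in> plane_triangle" using e(2) by blast
          then show "f (singular_face (Suc 1) j \<sigma> (edge_point t)) = cis (2 * pi * (g \<circ> e) t)"
            using g(2) edge_point_in_simplex[OF t] by (simp add: singular_face_def e(3))
        qed
      qed
      ultimately show ?thesis
        by (simp add: angular_cochain_def floor_change_lift)
    qed
    have "?\<theta> 1 (singular_face (Suc 1) 0 \<sigma>) = of_int (\<lfloor>g (0, 1)\<rfloor> - \<lfloor>g (1, 0)\<rfloor>)"
      by (subst edge[of 0 "\<lambda>t. (1 - t, t)"])
        (auto simp: plane_triangle_def simplical_face_def edge_point_def triangle_point_def fun_eq_iff
          intro!: continuous_intros)
    moreover have "?\<theta> 1 (singular_face (Suc 1) 1 \<sigma>) = of_int (\<lfloor>g (0, 1)\<rfloor> - \<lfloor>g (0, 0)\<rfloor>)"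
      by (subst edge[of 1 "\<lambda>t. (0, t)"])
        (auto simp: plane_triangle_def simplical_face_def edge_point_def triangle_point_def fun_eq_iff
          intro!: continuous_intros)
    moreover have "?\<theta> 1 (singular_face (Suc 1) 2 \<sigma>) = of_int (\<lfloor>g (1, 0)\<rfloor> - \<lfloor>g (0, 0)\<rfloor>)"
      by (subst edge[of 2 "\<lambda>t. (t, 0)"])
        (auto simp: plane_triangle_def simplical_face_def edge_point_def triangle_point_def fun_eq_iff
          intro!: continuous_intros)
    moreover have "coboundary X ?\<theta> k \<sigma> = ?\<theta> 1 (singular_face (Suc 1) 0 \<sigma>)
        - ?\<theta> 1 (singular_face (Suc 1) 1 \<sigma>) + ?\<theta> 1 (singular_face (Suc 1) 2 \<sigma>)"
      using \<sigma> by (simp add: k numeral_2_eq_2)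
    ultimately show ?thesis by simp
  next
    case False
    then show ?thesis
      by (cases k; cases "k = 2") (auto simp: angular_cochain_def numeral_2_eq_2 simp del: sum.atMost_Suc)
  qed
  ultimately show ?thesis
    by (auto simp: cocycles_def)
qed

text \<open>
  The argument of an angular cochain is a path on the whole real line, of which only the part over the
  unit interval is meaningful: outside it, restricted simplices take default values.
\<close>

lemma floor_change_cong:
  assumes "\<And>t. t \<in> {0..1} \<Longrightarrow> p t = p' t"
  shows "floor_change p = floor_change p'"
  using assms by (simp add: floor_change_def is_lift_def)

text \<open>
  Only the term that splits a simplex into its first edge and the opposite back face survives, because
  an angular cochain lives in degree 1.
\<close>

lemma cup_angular_cochain:
  assumes "singular_simplex (Suc m) X \<sigma>"
  shows "cup X (angular_cochain X f) \<psi> (Suc m) \<sigma>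
           = of_int (floor_change (\<lambda>t. f (\<sigma> (edge_point t)))) * \<psi> m (back_face 1 m \<sigma>)"
proof -
  have s1: "singular_simplex 1 X (front_face 1 \<sigma>)"
    by (rule singular_simplex_front_face[OF assms]) simp
  have "cup X (angular_cochain X f) \<psi> (Suc m) \<sigma>
      = (\<Sum>i\<le>Suc m. angular_cochain X f i (front_face i \<sigma>)
            * \<psi> (Suc m - i) (back_face i (Suc m - i) \<sigma>))"
    using assms by (simp add: cup_def del: sum.atMost_Suc)
  also have "\<dots> = (\<Sum>i\<in>{1}. angular_cochain X f i (front_face i \<sigma>)
            * \<psi> (Suc m - i) (back_face i (Suc m - i) \<sigma>))"
    by (rule sum.mono_neutral_right) (auto simp: angular_cochain_def)
  also have "\<dots> = of_int (floor_change (\<lambda>t. f (front_face 1 \<sigma> (edge_point t))))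
                    * \<psi> m (back_face 1 m \<sigma>)"
    using s1 by (simp add: angular_cochain_def)
  also have "floor_change (\<lambda>t. f (front_face 1 \<sigma> (edge_point t)))
               = floor_change (\<lambda>t. f (\<sigma> (edge_point t)))"
    by (rule floor_change_cong) (simp add: front_face_def edge_point_in_simplex[simplified])
  finally show ?thesis .
qed

lemma shift_shift: "shift_coords i (shift_coords j x) = shift_coords (i + j) x"
  by (auto simp: shift_coords_def fun_eq_iff)

text \<open>
  The map \<open>shift_coords j \<circ> edge_point\<close> parametrizes the edge from vertex \<open>j\<close> to vertex \<open>j + 1\<close>, so
  a product of angular cochains is evaluated along the path through successive vertices.
\<close>

lemma foldr_cup_angular_cochains:
  assumes "singular_simplex (length fs) X \<sigma>"
  shows "foldr (cup X) (map (angular_cochain X) fs) \<one>\<^bsub>cochain_ring X\<^esub> (length fs) \<sigma>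
    = (\<Prod>j<length fs. of_int (floor_change (\<lambda>t. (fs ! j) (\<sigma> (shift_coords j (edge_point t))))))"
  using assms
proof (induction fs arbitrary: \<sigma>)
  case Nil
  then show ?case by (simp add: cochain_ring_def)
next
  case (Cons f fs)
  let ?m = "length fs"
  have \<sigma>: "singular_simplex (Suc ?m) X \<sigma>" "singular_simplex ?m X (back_face 1 ?m \<sigma>)"
    using Cons.prems by (auto intro!: singular_simplex_back_face)
  have edge: "floor_change (\<lambda>t. (fs ! j) (back_face 1 ?m \<sigma> (shift_coords j (edge_point t))))
      = floor_change (\<lambda>t. (fs ! j) (\<sigma> (shift_coords (Suc j) (edge_point t))))" if "j < ?m" for j
  proof (rule floor_change_cong)
    fix t :: real assume "t \<in> {0..1}"
    then have "shift_coords j (edge_point t) \<in> standard_simplex ?m"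
      using shift_coords_simplex[OF edge_point_in_simplex, of t j]
        standard_simplex_mono[of "j + 1" ?m] that by auto
    then show "(fs ! j) (back_face 1 ?m \<sigma> (shift_coords j (edge_point t)))
        = (fs ! j) (\<sigma> (shift_coords (Suc j) (edge_point t)))"
      by (simp add: back_face_def shift_shift)
  qed
  have "shift_coords 0 x = x" for x
    by (simp add: shift_coords_def)
  then show ?case
    using \<sigma> Cons.IH[OF \<sigma>(2)] edge
    by (simp add: cup_angular_cochain prod.lessThan_Suc_shift del: prod.lessThan_Suc)
qed

section \<open>The triangulated cube\<close>

definition tail_sum :: "nat \<Rightarrow> nat \<Rightarrow> (nat \<Rightarrow> real) \<Rightarrow> real" where
  "tail_sum r q x = (\<Sum>k\<in>{r<..q}. x k)"

text \<open>
  Vertex \<open>k\<close> of the simplex of \<open>\<rho>\<close> is the corner of the cube whose \<open>i\<close>-th coordinate is 1 exactly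
  if \<open>\<rho> i < k\<close>: walking along the vertices raises coordinate \<open>i\<close> from 0 to 1 in step \<open>\<rho> i\<close>. In
  barycentric coordinates \<open>x\<close>, coordinate \<open>i\<close> is therefore the sum of the \<open>x\<^sub>k\<close> with \<open>k > \<rho> i\<close>. A
  permutation of \<open>{..<q}\<close> fixes every \<open>i \<ge> q\<close>, so there the sum is empty, and the simplex lies in the
  coordinate torus of the first \<open>q\<close> coordinates.
\<close>

definition cube_simplex ::
    "nat \<Rightarrow> nat \<Rightarrow> (nat \<Rightarrow> nat) \<Rightarrow> (nat \<Rightarrow> real) \<Rightarrow> nat \<Rightarrow> complex" where
  "cube_simplex n q \<rho> = restrict
     (\<lambda>x. restrict (\<lambda>i. cis (2 * pi * tail_sum (\<rho> i) q x)) {..<n}) (standard_simplex q)"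

lemma singular_simplex_cube_simplex: "singular_simplex q (torus n) (cube_simplex n q \<rho>)"
proof -
  let ?D = "subtopology (powertop_real UNIV) (standard_simplex q)"
  have proj: "continuous_map ?D euclideanreal (\<lambda>x. x k)" for k
    by (intro continuous_map_from_subtopology continuous_map_product_projection) simp
  have "continuous_map ?D (top_of_set (sphere 0 1)) (\<lambda>x. cis (2 * pi * tail_sum r q x))" for r
  proof -
    have "continuous_map ?D euclideanreal (tail_sum r q)"
      unfolding tail_sum_def[abs_def] by (intro continuous_map_sum proj) simp
    moreover have "continuous_map euclideanreal (top_of_set (sphere 0 1)) (\<lambda>y. cis (2 * pi * y))"
      by (auto simp: continuous_map_in_subtopology intro!: continuous_intros)
    ultimately show ?thesis
      using continuous_map_compose by (fastforce simp: o_def)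
  qed
  then have "continuous_map ?D (torus n)
      (\<lambda>x. restrict (\<lambda>i. cis (2 * pi * tail_sum (\<rho> i) q x)) {..<n})"
    by (auto simp: torus_def continuous_map_componentwise)
  then show ?thesis
    unfolding singular_simplex_def cube_simplex_def
    by (auto intro: continuous_map_eq)
qed

text \<open>
  Along edge \<open>j\<close>, a coordinate raised in an earlier step is 1, one raised in a later step is 0, and the
  one raised in step \<open>j\<close> runs from 0 to 1.
\<close>

lemma tail_sum_edge:
  assumes "j < q"
  shows "tail_sum r q (shift_coords j (edge_point t)) = (if r < j then 1 else if r = j then t else 0)"
proof -
  have "shift_coords j (edge_point t) k = (if k = j then 1 - t else 0) + (if k = Suc j then t else 0)"
    for k by (auto simp: shift_coords_def edge_point_def)
  then show ?thesis
    using assms by (auto simp: tail_sum_def sum.distrib sum.delta)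
qed

lemma floor_change_cube_simplex:
  assumes "j < q" "i < n"
  shows "floor_change (\<lambda>t. cube_simplex n q \<rho> (shift_coords j (edge_point t)) i)
           = (if \<rho> i = j then 1 else 0)"
proof -
  let ?g = "\<lambda>t. tail_sum (\<rho> i) q (shift_coords j (edge_point t))"
  have "shift_coords j (edge_point t) \<in> standard_simplex q" if "t \<in> {0..1}" for t
    using shift_coords_simplex[OF edge_point_in_simplex[OF that], of j]
      standard_simplex_mono[of "j + 1" q] assms(1) by auto
  then have "is_lift (\<lambda>t. cube_simplex n q \<rho> (shift_coords j (edge_point t)) i) ?g"
    using assms(2) unfolding is_lift_def tail_sum_edge[OF assms(1)]
    by (cases "\<rho> i < j"; cases "\<rho> i = j") (auto simp: cube_simplex_def tail_sum_edge[OF assms(1)])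
  then show ?thesis
    by (simp add: floor_change_lift tail_sum_edge[OF assms(1)])
qed

text \<open>
  The \<open>j\<close>-th factor is 1 if coordinate \<open>j\<close> is the one that is raised in step \<open>j\<close>, and 0 otherwise; all
  factors are 1 only for the identity.
\<close>

lemma angular_product_cube_simplex:
  assumes "\<rho> permutes {..<q}" "q \<le> n"
  shows "foldr (cup (torus n)) (map (\<lambda>i. angular_cochain (torus n) (\<lambda>x. x i)) [0..<q])
           \<one>\<^bsub>cochain_ring (torus n)\<^esub> q (cube_simplex n q \<rho>) = (if \<rho> = id then 1 else 0)"
proof -
  have "foldr (cup (torus n)) (map (\<lambda>i. angular_cochain (torus n) (\<lambda>x. x i)) [0..<q])
           \<one>\<^bsub>cochain_ring (torus n)\<^esub> q (cube_simplex n q \<rho>)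
      = (\<Prod>j<q. of_int (if \<rho> j = j then 1 else 0))"
    using foldr_cup_angular_cochains[of "map (\<lambda>i x. x i) [0..<q]" "torus n" "cube_simplex n q \<rho>"]
      singular_simplex_cube_simplex[of q n \<rho>] assms(2)
    by (simp add: o_def floor_change_cube_simplex)
  also have "\<dots> = (if \<forall>j<q. \<rho> j = j then 1 else 0)"
    by (auto intro!: prod_zero)
  also have "(\<forall>j<q. \<rho> j = j) \<longleftrightarrow> \<rho> = id"
    using assms(1) by (auto simp: permutes_def fun_eq_iff)
  finally show ?thesis .
qed

text \<open>
  Passing to face \<open>j\<close> inserts the barycentric coordinate 0 at position \<open>j\<close> and moves the later ones
  up by one, so the sum starts one index earlier, relative to \<open>x\<close>, if the inserted entry lies before
  the range of summation.
\<close>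

lemma tail_sum_face:
  assumes "j \<le> Suc m"
  shows "tail_sum r (Suc m) (simplical_face j x) = (\<Sum>k = (if r < j then Suc r else r)..m. x k)"
proof -
  have shift: "(\<Sum>k\<in>{s<..Suc m}. simplical_face j x k) = (\<Sum>k=s..m. x k)" if "j \<le> s" for s
    using that by (intro sum.reindex_bij_witness[of _ Suc "\<lambda>k. k - 1"]) (auto simp: simplical_face_def)
  show ?thesis
  proof (cases "r < j")
    case True
    have split: "{r<..Suc m} = insert j ({r<..<j} \<union> {j<..Suc m})" "{Suc r..m} = {r<..<j} \<union> {j..m}"
      using True assms by auto
    have "tail_sum r (Suc m) (simplical_face j x)
        = simplical_face j x j + ((\<Sum>k\<in>{r<..<j}. simplical_face j x k)
          + (\<Sum>k\<in>{j<..Suc m}. simplical_face j x k))"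
      unfolding tail_sum_def split by (subst sum.insert, simp, simp, subst sum.union_disjoint) auto
    also have "(\<Sum>k\<in>{r<..<j}. simplical_face j x k) = (\<Sum>k\<in>{r<..<j}. x k)"
      by (intro sum.cong) (auto simp: simplical_face_def)
    also have "simplical_face j x j = 0"
      by (simp add: simplical_face_def)
    also have "(\<Sum>k\<in>{j<..Suc m}. simplical_face j x k) = (\<Sum>k=j..m. x k)"
      by (rule shift) simp
    also have "0 + ((\<Sum>k\<in>{r<..<j}. x k) + (\<Sum>k=j..m. x k)) = (\<Sum>k=Suc r..m. x k)"
      unfolding split by (subst sum.union_disjoint) auto
    finally show ?thesis using True by simp
  next
    case False
    then show ?thesis using shift[of r] by (simp add: tail_sum_def)
  qed
qed

lemma cube_simplex_face_eqI:
  assumes "j \<le> Suc m" "j' \<le> Suc m"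
    and "\<And>x i. x \<in> standard_simplex m \<Longrightarrow>
           cis (2 * pi * tail_sum (\<rho> i) (Suc m) (simplical_face j x))
             = cis (2 * pi * tail_sum (\<rho>' i) (Suc m) (simplical_face j' x))"
  shows "singular_face (Suc m) j (cube_simplex n (Suc m) \<rho>)
           = singular_face (Suc m) j' (cube_simplex n (Suc m) \<rho>')"
  using assms simplical_face_simplex[of _ m]
  by (auto simp: singular_face_def cube_simplex_def restrict_def fun_eq_iff)

text \<open>
  Face \<open>j\<close> omits vertex \<open>j\<close>, and with it the order of the two steps \<open>j - 1\<close> and \<open>j\<close> that meet there.
\<close>

lemma inner_face_transpose:
  assumes "0 < j" "j \<le> m"
  shows "singular_face (Suc m) j (cube_simplex n (Suc m) (Transposition.transpose (j - 1) j \<circ> \<rho>))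
           = singular_face (Suc m) j (cube_simplex n (Suc m) \<rho>)"
proof (rule cube_simplex_face_eqI)
  obtain l where l: "j = Suc l" using assms(1) by (cases j) auto
  fix x :: "nat \<Rightarrow> real" and i
  have "tail_sum ((Transposition.transpose (j - 1) j \<circ> \<rho>) i) (Suc m) (simplical_face j x)
      = tail_sum (\<rho> i) (Suc m) (simplical_face j x)"
    using assms by (auto simp: tail_sum_face l Transposition.transpose_def)
  then show "cis (2 * pi * tail_sum ((Transposition.transpose (j - 1) j \<circ> \<rho>) i) (Suc m) (simplical_face j x))
      = cis (2 * pi * tail_sum (\<rho> i) (Suc m) (simplical_face j x))"
    by simp
qed (use assms in auto)

text \<open>
  The cycle on \<open>{..m}\<close> that sends 0 to \<open>m\<close> and decreases all other entries by 1, built from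
  transpositions so that its sign is immediate.
\<close>

primrec cycle_down :: "nat \<Rightarrow> nat \<Rightarrow> nat" where
  "cycle_down 0 = id"
| "cycle_down (Suc m) = Transposition.transpose m (Suc m) \<circ> cycle_down m"

lemma cycle_down_permutes: "cycle_down m permutes {..m}"
proof (induction m)
  case 0
  show ?case by (simp only: cycle_down.simps permutes_id)
next
  case (Suc m)
  have "cycle_down m permutes {..Suc m}"
    using Suc by (rule permutes_subset) auto
  moreover have "Transposition.transpose m (Suc m) permutes {..Suc m}"
    by (rule permutes_swap_id) auto
  ultimately show ?case
    unfolding cycle_down.simps by (rule permutes_compose)
qed

lemma cycle_down_apply:
  "cycle_down m r = (if r = 0 then m else if r \<le> m then r - 1 else r)"
  by (induction m) (auto simp: Transposition.transpose_def)

lemma sign_cycle_down: "sign (cycle_down m) = (-1) ^ m"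
proof (induction m)
  case (Suc m)
  have "permutation (cycle_down m)"
    using cycle_down_permutes by (rule permutes_imp_permutation[rotated]) simp
  then show ?case
    unfolding cycle_down.simps using Suc
    by (subst sign_compose) (simp_all add: permutation_swap_id sign_swap_id)
qed simp

text \<open>
  Face 0 omits the first step: the coordinate \<open>i\<close> with \<open>\<rho> i = 0\<close> is 1 throughout. Performing that step
  last instead and then omitting it keeps this coordinate at 0 throughout, which is the same
  point of the circle, while the other steps move down by one.
\<close>

lemma outer_face_cycle:
  assumes "\<rho> permutes {..m}"
  shows "singular_face (Suc m) 0 (cube_simplex n (Suc m) \<rho>)
           = singular_face (Suc m) (Suc m) (cube_simplex n (Suc m) (cycle_down m \<circ> \<rho>))"
proof (rule cube_simplex_face_eqI)
  fix x :: "nat \<Rightarrow> real" and i assume "x \<in> standard_simplex m"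
  then have "(\<Sum>k=0..m. x k) = 1"
    by (simp add: standard_simplex_def atLeast0AtMost)
  then show "cis (2 * pi * tail_sum (\<rho> i) (Suc m) (simplical_face 0 x))
      = cis (2 * pi * tail_sum ((cycle_down m \<circ> \<rho>) i) (Suc m) (simplical_face (Suc m) x))"
    by (cases "\<rho> i = 0") (auto simp: tail_sum_face cycle_down_apply)
qed auto

lemma signed_sum_compose_left:
  fixes h :: "(nat \<Rightarrow> nat) \<Rightarrow> 'k::comm_ring_1"
  assumes "\<tau> permutes {..m::nat}"
  shows "(\<Sum>\<rho> | \<rho> permutes {..m}. of_int (sign \<rho>) * h (\<tau> \<circ> \<rho>))
           = of_int (sign \<tau>) * (\<Sum>\<rho> | \<rho> permutes {..m}. of_int (sign \<rho>) * h \<rho>)"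
proof -
  have perm: "permutation \<rho>" if "\<rho> permutes {..m}" for \<rho>
    using that by (rule permutes_imp_permutation[rotated]) simp
  have "(\<Sum>\<rho> | \<rho> permutes {..m}. of_int (sign \<rho>) * h \<rho>)
      = (\<Sum>\<rho> | \<rho> permutes {..m}. of_int (sign (\<tau> \<circ> \<rho>)) * h (\<tau> \<circ> \<rho>))"
    by (rule setum_permutations_compose_left[OF assms])
  also have "\<dots> = of_int (sign \<tau>) * (\<Sum>\<rho> | \<rho> permutes {..m}. of_int (sign \<rho>) * h (\<tau> \<circ> \<rho>))"
    using perm assms by (auto simp: sum_distrib_left sign_compose mult.assoc intro!: sum.cong)
  finally have "of_int (sign \<tau>) * (\<Sum>\<rho> | \<rho> permutes {..m}. of_int (sign \<rho>) * h \<rho>)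
      = of_int (sign \<tau> * sign \<tau>) * (\<Sum>\<rho> | \<rho> permutes {..m}. of_int (sign \<rho>) * h (\<tau> \<circ> \<rho>))"
    by (simp add: mult.assoc del: sign_idempotent)
  then show ?thesis by simp
qed

text \<open>
  The signed sum of the simplices \<open>cube_simplex n q \<rho>\<close> is a cycle, stated dually. Inner faces give sums
  that equal their own negatives, which is where 2 must not be a zero divisor. Face 0 and face \<open>q\<close>
  match under a cycle of sign \<open>(-1)^(q - 1)\<close>, while they enter the boundary with signs \<open>1\<close> and
  \<open>(-1)^q\<close>, so they cancel.
\<close>

lemma signed_sum_coboundary:
  fixes \<xi> :: "(nat \<Rightarrow> complex, 'k::{idom, ring_char_0}) cochain"
  shows "(\<Sum>\<rho> | \<rho> permutes {..<q}. of_int (sign \<rho>) * coboundary (torus n) \<xi> q (cube_simplex n q \<rho>)) = 0"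
proof (cases q)
  case 0
  then show ?thesis by simp
next
  case (Suc m)
  define F where "F j \<rho> = \<xi> m (singular_face (Suc m) j (cube_simplex n (Suc m) \<rho>))" for j \<rho>
  define S where "S j = (\<Sum>\<rho> | \<rho> permutes {..m}. of_int (sign \<rho>) * F j \<rho>)" for j
  have inner: "S (Suc j) = 0" if j: "j < m" for j
  proof -
    have "S (Suc j) = (\<Sum>\<rho> | \<rho> permutes {..m}. of_int (sign \<rho>) * F (Suc j) (Transposition.transpose j (Suc j) \<circ> \<rho>))"
      using inner_face_transpose[of "Suc j" m n] j by (simp add: S_def F_def)
    also have "\<dots> = - S (Suc j)"
      using j by (subst signed_sum_compose_left) (auto simp: permutes_swap_id sign_swap_id S_def)
    finally have "2 * S (Suc j) = 0" by simp
    then show ?thesis by simp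
  qed
  have outer: "S 0 = (-1) ^ m * S (Suc m)"
  proof -
    have "S 0 = (\<Sum>\<rho> | \<rho> permutes {..m}. of_int (sign \<rho>) * F (Suc m) (cycle_down m \<circ> \<rho>))"
      by (simp add: S_def F_def outer_face_cycle)
    then show ?thesis
      by (simp add: signed_sum_compose_left cycle_down_permutes sign_cycle_down S_def)
  qed
  have "(\<Sum>\<rho> | \<rho> permutes {..<q}. of_int (sign \<rho>) * coboundary (torus n) \<xi> q (cube_simplex n q \<rho>))
      = (\<Sum>\<rho> | \<rho> permutes {..m}. \<Sum>j\<le>Suc m. (-1) ^ j * (of_int (sign \<rho>) * F j \<rho>))"
    using singular_simplex_cube_simplex[of "Suc m" n]
    by (simp add: Suc F_def sum_distrib_left lessThan_Suc_atMost mult.left_commute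
        del: sum.atMost_Suc)
  also have "\<dots> = (\<Sum>j\<le>Suc m. (-1) ^ j * S j)"
    by (subst sum.swap) (simp add: S_def sum_distrib_left)
  also have "\<dots> = S 0 + (\<Sum>j<m. (-1) ^ Suc j * S (Suc j)) + (-1) ^ Suc m * S (Suc m)"
    by (subst sum.atMost_Suc_shift) (simp add: lessThan_Suc_atMost[symmetric])
  also have "\<dots> = 0"
    by (simp add: inner outer)
  finally show ?thesis .
qed

section \<open>The p-length of the torus\<close>

lemma angular_product_not_coboundary:
  assumes "q \<le> n"
  shows "foldr (cup (torus n)) (map (\<lambda>i. angular_cochain (torus n) (\<lambda>x. x i)) [0..<q])
           \<one>\<^bsub>cochain_ring (torus n)\<^esub>
         \<notin> (coboundaries (torus n) :: (nat \<Rightarrow> complex, 'k::{idom, ring_char_0}) cochain set)"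
    (is "?P \<notin> _")
proof
  assume "?P \<in> coboundaries (torus n)"
  then obtain \<xi> where "?P = coboundary (torus n) \<xi>"
    by (auto simp: coboundaries_def)
  then have "(\<Sum>\<rho> | \<rho> permutes {..<q}. of_int (sign \<rho>) * ?P q (cube_simplex n q \<rho>)) = 0"
    using signed_sum_coboundary by simp
  moreover have "(\<Sum>\<rho> | \<rho> permutes {..<q}. of_int (sign \<rho>) * ?P q (cube_simplex n q \<rho>))
      = (\<Sum>\<rho> | \<rho> permutes {..<q}. if \<rho> = id then 1 else 0)"
    using assms by (intro sum.cong) (auto simp: angular_product_cube_simplex)
  ultimately show False
    by (simp add: finite_permutations permutes_id)
qed

lemma p_length_torus:
  assumes "p \<le> n"
  shows "p_length TYPE('k::{idom, ring_char_0}) n p (torus n) = n - p"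
proof -
  let ?T = "torus n"
  let ?H = "cohomology_ring ?T :: (nat \<Rightarrow> complex, 'k) cochain set ring"
  define P where "P q \<longleftrightarrow> (\<exists>as. length as = q \<and>
        (\<forall>a\<in>set as. \<exists>d>0. a \<in> cohomology_part d ?T) \<and>
        foldr (\<otimes>\<^bsub>?H\<^esub>) as \<one>\<^bsub>?H\<^esub> \<noteq> \<zero>\<^bsub>?H\<^esub> \<and>
        (\<exists>d. d + p \<le> n \<and> foldr (\<otimes>\<^bsub>?H\<^esub>) as \<one>\<^bsub>?H\<^esub> \<in> cohomology_part d ?T))" for q
  define \<theta> :: "nat \<Rightarrow> (nat \<Rightarrow> complex, 'k) cochain" where "\<theta> i = angular_cochain ?T (\<lambda>x. x i)" for i
  define cls :: "(nat \<Rightarrow> complex, 'k) cochain \<Rightarrow> (nat \<Rightarrow> complex, 'k) cochain set"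
    where "cls \<phi> = coboundaries ?T +>\<^bsub>cocycle_ring ?T\<^esub> \<phi>" for \<phi>
  let ?as = "map cls (map \<theta> [0..<n - p])"
  let ?prod = "foldr (\<otimes>\<^bsub>?H\<^esub>) ?as \<one>\<^bsub>?H\<^esub>"
  have cocycle: "\<theta> i \<in> cocycles ?T" if "i < n" for i
    unfolding \<theta>_def using that
    by (intro angular_cochain_cocycle)
      (use continuous_map_product_projection[of i "{..<n}" "\<lambda>_. top_of_set (sphere 0 1)"]
        in \<open>simp add: torus_def\<close>)
  have deg1: "a \<in> cohomology_part 1 ?T" if "a \<in> set ?as" for a
    using that cocycle by (auto simp: cohomology_part_def cls_def) (auto simp: \<theta>_def angular_cochain_def)
  have "set (map \<theta> [0..<n - p]) \<subseteq> cocycles ?T"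
    using cocycle by auto
  from foldr_classes[OF this] have "?prod = cls (foldr (cup ?T) (map \<theta> [0..<n - p]) \<one>\<^bsub>cochain_ring ?T\<^esub>)"
    and "foldr (cup ?T) (map \<theta> [0..<n - p]) \<one>\<^bsub>cochain_ring ?T\<^esub> \<in> cocycles ?T"
    by (simp_all add: cls_def[abs_def])
  then have "?prod \<noteq> \<zero>\<^bsub>?H\<^esub>"
    using class_eq_zeroD angular_product_not_coboundary[of "n - p" n, where 'k = 'k]
    unfolding cls_def \<theta>_def by fastforce
  moreover have "?prod \<in> cohomology_part (n - p) ?T"
    using foldr_in_cohomology_part[of ?as "\<lambda>_. 1" ?T] deg1 by (simp add: sum_list_triv o_def)
  ultimately have "P (n - p)"
    unfolding P_def using deg1 assms
    by (intro exI[of _ ?as] conjI ballI exI[of _ "1::nat"] exI[of _ "n - p"]) auto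
  moreover have "q \<le> n - p" if "P q" for q
    using that length_le_degree unfolding P_def by fastforce
  ultimately have "Greatest P = n - p"
    by (rule Greatest_equality)
  then show ?thesis
    by (simp add: p_length_def P_def[abs_def])
qed

theorem proposition1p9:
  fixes n p :: nat
  assumes "n \<ge> 1" and "p \<le> n"
  shows "p_length TYPE(int) n p (torus n) = n - p \<and>
         p_length TYPE(real) n p (torus n) = n - p"
  using assms(2) by (simp add: p_length_torus)

end
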